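(* Let $k>2$ be an integer. There is a rational number $q$ (depending only on $k$) such that for every real $x$ with $0<|x|<1$, $$\int_0^\pi \theta \sin^3 \theta \left[(1+x\cos\theta)^{1/k}+(1-x\cos \theta)^{1/k}\right]d\theta=\frac{4\pi}{3}\,\frac{q}{x^3}\left[\frac{p(x)}{(1-x)^{(2k-1)/k}}+\frac{\tilde p(x)}{(1+x)^{(2k-1)/k}}\right],$$ where $p$ and $\tilde p$ are the quintic polynomials $$p(x)=(x-1)^4 \left(x+\frac{k}{2k+1}\right),\qquad \tilde p(x)=-p(-x)=(x+1)^4\left(x-\frac{k}{2k+1}\right).$$
   Context: Fractional powers of positive reals are the positive real ones. *)

theory Defs
  imports "HOL-Analysis.Analysis" "HOL-Computational_Algebra.Polynomial"
begin

definition p_poly :: "nat \<Rightarrow> real poly" where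
  "p_poly k = [:-1, 1:] ^ 4 * [:real k / (2 * real k + 1), 1:]"

definition p_tilde_poly :: "nat \<Rightarrow> real poly" where
  "p_tilde_poly k = [:1, 1:] ^ 4 * [:- (real k / (2 * real k + 1)), 1:]"

end

theory Submission
  imports Defs
begin

text \<open>The factor multiplying \<open>\<theta>\<close> is invariant under \<open>\<theta> \<mapsto> \<pi> - \<theta>\<close>, so \<open>\<theta>\<close> may be replaced by
  its mean \<open>\<pi>/2\<close>. The substitution \<open>u = cos \<theta>\<close> then leaves the integral of
  \<open>(1 - u\<^sup>2) (1 + x u)\<^sup>a\<close> over \<open>[-1, 1]\<close> with \<open>a = 1/k\<close>, which is elementary in \<open>s = 1 + x u\<close>
  because \<open>x\<^sup>2 (1 - u\<^sup>2) = (x\<^sup>2 - 1) + 2 s - s\<^sup>2\<close>. The constant that comes out is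
  \<open>q = 3 / (2 (a + 1) (a + 3))\<close>.\<close>

text \<open>Reflecting \<open>t\<close> to \<open>c - t\<close> turns the weight \<open>t\<close>
  into \<open>c - t\<close> without changing the integral \<open>I\<close>. The two weights add up
  to the constant \<open>c\<close>, so \<open>2 * I = c * J\<close>. Continuity supplies the
  existence of \<open>I\<close>.\<close>

lemma has_integral_mult_symmetric:
  fixes f :: "real \<Rightarrow> real"
  assumes "c \<ge> 0" and cont: "continuous_on {0..c} f"
    and sym: "\<And>t. f (c - t) = f t"
    and J: "(f has_integral J) {0..c}"
  shows "((\<lambda>t. t * f t) has_integral (c / 2 * J)) {0..c}"
proof -
  have "(\<lambda>t. t * f t) integrable_on {0..c}"
    by (intro integrable_continuous_interval continuous_intros cont)
  then obtain I where I: "((\<lambda>t. t * f t) has_integral I) {0..c}"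
    by blast
  have "((\<lambda>t. (c - t) * f (c - t)) has_integral I) {0..c}"
    using has_integral_affinity[OF I[unfolded interval_cbox], of "-1" c] \<open>c \<ge> 0\<close>
    by (auto simp: image_affinity_atLeastAtMost algebra_simps)
  then have "((\<lambda>t. t * f t + (c - t) * f t) has_integral (I + I)) {0..c}"
    using I by (intro has_integral_add) (simp_all add: sym)
  moreover have "((\<lambda>t. t * f t + (c - t) * f t) has_integral (c * J)) {0..c}"
    using has_integral_mult_right[OF J, of c] by (simp add: algebra_simps)
  ultimately have "I + I = c * J"
    by (rule has_integral_unique)
  then have "I = c / 2 * J" by simp
  with I show ?thesis by simp
qed

lemma one_plus_mult_cos_pos:
  fixes x :: real
  assumes "\<bar>x\<bar> < 1"
  shows "0 < 1 + x * cos t"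
proof -
  have "\<bar>x * cos t\<bar> \<le> \<bar>x\<bar> * 1"
    unfolding abs_mult by (intro mult_left_mono) auto
  with assms show ?thesis by linarith
qed

text \<open>The substitution is carried out by exhibiting an antiderivative in \<open>t\<close>.
  Both signs of \<open>x\<close> are allowed, so that the summand with \<open>1 - x * cos t\<close>
  is the instance at \<open>- x\<close>.\<close>

lemma has_integral_sin_cubed_powr:
  fixes x a :: real
  assumes x: "x \<noteq> 0" "\<bar>x\<bar> < 1" and a: "a > 0"
  shows "((\<lambda>t. sin t ^ 3 * (1 + x * cos t) powr a) has_integral
    2 / ((a + 1) * (a + 3) * x ^ 3) *
     ((1 + x) powr (a + 2) * (x - 1 / (a + 2)) + (1 - x) powr (a + 2) * (x + 1 / (a + 2)))) {0..pi}"
proof -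
  \<comment> \<open>Termwise antiderivative of
    \<open>s powr a * ((x\<^sup>2 - 1) + 2 * s - s\<^sup>2)\<close>.\<close>
  define P where "P s = (x\<^sup>2 - 1) * s powr (a + 1) / (a + 1) + 2 * s powr (a + 2) / (a + 2)
    - s powr (a + 3) / (a + 3)" for s
  have powr_Suc: "s powr (b + 1) = s powr b * s" if "s > 0" for s b :: real
    using that by (simp add: powr_add)
  have P_deriv: "(P has_real_derivative s powr a * ((x\<^sup>2 - 1) + 2 * s - s\<^sup>2)) (at s)" if "s > 0" for s
  proof -
    have "s powr (a + 1) = s powr a * s" "s powr (a + 2) = s powr a * s\<^sup>2"
      using that powr_Suc[of s a] powr_Suc[of s "a + 1"] by (simp_all add: power2_eq_square add.assoc)
    moreover have "((\<lambda>s. s powr b / b) has_real_derivative s powr (b - 1)) (at s)" if "b > 0" for b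
      using \<open>s > 0\<close> that by (auto intro!: derivative_eq_intros)
    from this[of "a + 1"] this[of "a + 2"] this[of "a + 3"]
    have "((\<lambda>s. (x\<^sup>2 - 1) * (s powr (a + 1) / (a + 1)) + 2 * (s powr (a + 2) / (a + 2))
        - s powr (a + 3) / (a + 3)) has_real_derivative
        (x\<^sup>2 - 1) * s powr a + 2 * s powr (a + 1) - s powr (a + 2)) (at s)"
      using a by (intro DERIV_diff DERIV_add DERIV_cmult) (simp_all add: add.commute)
    ultimately show ?thesis
      unfolding P_def by (simp add: algebra_simps)
  qed
  \<comment> \<open>The quadratic in \<open>s\<close> contributes
    \<open>x\<^sup>2 * (sin t)\<^sup>2\<close> and the inner derivative \<open>- x * sin t\<close>;
    dividing by \<open>- x ^ 3\<close> leaves exactly \<open>sin t ^ 3\<close>.\<close>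
  have "((\<lambda>t. - P (1 + x * cos t) / x ^ 3) has_real_derivative
      sin t ^ 3 * (1 + x * cos t) powr a) (at t)" for t
  proof -
    define s where "s = 1 + x * cos t"
    have "((\<lambda>t. 1 + x * cos t) has_real_derivative x * - sin t) (at t)"
      by (auto intro!: derivative_eq_intros)
    from DERIV_cdivide[OF DERIV_minus[OF DERIV_chain2[OF P_deriv this]]]
    have "((\<lambda>t. - P (1 + x * cos t) / x ^ 3) has_real_derivative
        - (s powr a * ((x\<^sup>2 - 1) + 2 * s - s\<^sup>2) * (x * - sin t)) / x ^ 3) (at t)"
      using one_plus_mult_cos_pos x unfolding s_def by blast
    also have "(x\<^sup>2 - 1) + 2 * s - s\<^sup>2 = x\<^sup>2 * (sin t)\<^sup>2"
      unfolding sin_squared_eq s_def by (simp add: power2_eq_square algebra_simps)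
    also have "- (s powr a * (x\<^sup>2 * (sin t)\<^sup>2) * (x * - sin t)) / x ^ 3 = sin t ^ 3 * s powr a"
      using x by (simp add: power2_eq_square power3_eq_cube)
    finally show ?thesis
      unfolding s_def .
  qed
  then have "((\<lambda>t. sin t ^ 3 * (1 + x * cos t) powr a) has_integral
      (- P (1 + x * cos pi) / x ^ 3 - - P (1 + x * cos 0) / x ^ 3)) {0..pi}"
    by (intro fundamental_theorem_of_calculus)
      (auto simp: has_real_derivative_iff_has_vector_derivative[symmetric]
        intro: has_field_derivative_at_within)
  then have FTC: "((\<lambda>t. sin t ^ 3 * (1 + x * cos t) powr a) has_integral
      (P (1 + x) - P (1 - x)) / x ^ 3) {0..pi}"
    by (simp add: diff_divide_distrib)
  \<comment> \<open>For \<open>s = 1 + y\<close> with \<open>y\<^sup>2 = x\<^sup>2\<close>, the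
    coefficient \<open>x\<^sup>2 - 1\<close> equals \<open>s * (y - 1)\<close>, so all three terms
    of \<open>P\<close> share the factor \<open>s powr (a + 2)\<close>. The cofactor
    \<open>(y - 1) / (a + 1) + 2 / (a + 2) - (1 + y) / (a + 3)\<close> is linear in \<open>y\<close>
    with root \<open>1 / (a + 2)\<close>. Both endpoints are covered, by \<open>y = x\<close> and
    \<open>y = - x\<close>.\<close>
  have P_root: "P (1 + y) = 2 / ((a + 1) * (a + 3)) * ((1 + y) powr (a + 2) * (y - 1 / (a + 2)))"
    if "y\<^sup>2 = x\<^sup>2" "\<bar>y\<bar> < 1" for y
  proof -
    have pos: "1 + y > 0" using that by linarith
    have "(1 + y) powr (a + 2) = (1 + y) powr (a + 1) * (1 + y)"
      "(1 + y) powr (a + 3) = (1 + y) powr (a + 1) * (1 + y)\<^sup>2"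
      using powr_Suc[OF pos, of "a + 1"] powr_Suc[OF pos, of "a + 2"]
      by (simp_all add: power2_eq_square add.assoc)
    then show ?thesis
      unfolding P_def that(1)[symmetric] using a
      by (simp add: divide_simps power2_eq_square) (simp add: algebra_simps)
  qed
  have "P (1 + x) = 2 / ((a + 1) * (a + 3)) * ((1 + x) powr (a + 2) * (x - 1 / (a + 2)))"
    "P (1 - x) = 2 / ((a + 1) * (a + 3)) * - ((1 - x) powr (a + 2) * (x + 1 / (a + 2)))"
    using P_root[of x] P_root[of "- x"] x by (simp_all add: algebra_simps)
  then have "P (1 + x) - P (1 - x) = 2 / ((a + 1) * (a + 3)) *
      ((1 + x) powr (a + 2) * (x - 1 / (a + 2)) + (1 - x) powr (a + 2) * (x + 1 / (a + 2)))"
    by (simp only: right_diff_distrib[symmetric] diff_minus_eq_add)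
  with FTC show ?thesis by simp
qed

text \<open>Links the quartic factors of the two quintics, over their denominators, to the exponent
  \<open>a + 2\<close> of the integral formula.\<close>

lemma power4_div_powr:
  fixes y :: real
  assumes "y > 0" "k > 0"
  shows "y ^ 4 / y powr ((2 * real k - 1) / real k) = y powr (1 / real k + 2)"
proof -
  have "y ^ 4 = y powr 4" using assms by simp
  moreover have "4 - (2 * real k - 1) / real k = 1 / real k + 2"
    using assms by (simp add: field_simps)
  ultimately show ?thesis by (metis powr_diff)
qed

theorem mainTheorem9:
  fixes k :: nat
  assumes "k > 2"
  shows "degree (p_poly k) = 5 \<and> degree (p_tilde_poly k) = 5 \<and>
    (\<forall>x. poly (p_tilde_poly k) x = - poly (p_poly k) (- x)) \<and>
    (\<exists>q::rat. \<forall>x::real. 0 < \<bar>x\<bar> \<and> \<bar>x\<bar> < 1 \<longrightarrow>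
      ((\<lambda>\<theta>. \<theta> * sin \<theta> ^ 3 *
          ((1 + x * cos \<theta>) powr (1 / real k) + (1 - x * cos \<theta>) powr (1 / real k)))
        has_integral
        (4 * pi / 3 * (of_rat q / x ^ 3) *
          (poly (p_poly k) x / (1 - x) powr ((2 * real k - 1) / real k) +
           poly (p_tilde_poly k) x / (1 + x) powr ((2 * real k - 1) / real k))))
        {0..pi})"
proof (intro conjI)
  show "degree (p_poly k) = 5" "degree (p_tilde_poly k) = 5"
    unfolding p_poly_def p_tilde_poly_def by (subst degree_mult_eq; simp add: degree_power_eq)+
  show "\<forall>x. poly (p_tilde_poly k) x = - poly (p_poly k) (- x)"
  proof
    fix x :: real
    have "(- 1 - x) ^ 4 = (1 + x) ^ 4"
      by (simp add: power4_eq_xxxx algebra_simps)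
    then show "poly (p_tilde_poly k) x = - poly (p_poly k) (- x)"
      unfolding p_poly_def p_tilde_poly_def by (simp add: algebra_simps)
  qed
  define a where "a = 1 / real k"
  have a: "a > 0" "1 / (a + 2) = real k / (2 * real k + 1)"
    using assms by (simp_all add: a_def field_simps)
  \<comment> \<open>Chosen so that \<open>4 * pi / 3 * q\<close> equals \<open>pi / 2\<close> (the
    mean of \<theta>) times 2 (two equal integrals) times \<open>2 / ((a + 1) * (a + 3))\<close>; it
    is rational because \<open>a = 1 / k\<close>.\<close>
  define q :: rat where "q = 3 / 2 / ((1 / of_nat k + 1) * (1 / of_nat k + 3))"
  have q: "of_rat q = 3 / 2 / ((a + 1) * (a + 3))"
    by (simp add: q_def a_def of_rat_divide of_rat_mult of_rat_add)
  show "\<exists>q::rat. \<forall>x::real. 0 < \<bar>x\<bar> \<and> \<bar>x\<bar> < 1 \<longrightarrow>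
      ((\<lambda>\<theta>. \<theta> * sin \<theta> ^ 3 *
          ((1 + x * cos \<theta>) powr (1 / real k) + (1 - x * cos \<theta>) powr (1 / real k)))
        has_integral
        (4 * pi / 3 * (of_rat q / x ^ 3) *
          (poly (p_poly k) x / (1 - x) powr ((2 * real k - 1) / real k) +
           poly (p_tilde_poly k) x / (1 + x) powr ((2 * real k - 1) / real k))))
        {0..pi}"
  proof (intro exI[of _ q] allI impI)
    fix x :: real
    assume x: "0 < \<bar>x\<bar> \<and> \<bar>x\<bar> < 1"
    define V where "V = (1 - x) powr (a + 2) * (x + 1 / (a + 2))
      + (1 + x) powr (a + 2) * (x - 1 / (a + 2))"
    define f where "f t = sin t ^ 3 * ((1 + x * cos t) powr a + (1 - x * cos t) powr a)" for t
    have "(f has_integral (2 / ((a + 1) * (a + 3) * x ^ 3) * V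
        + 2 / ((a + 1) * (a + 3) * x ^ 3) * V)) {0..pi}"
    proof -
      have "((\<lambda>t. sin t ^ 3 * (1 + x * cos t) powr a) has_integral
          2 / ((a + 1) * (a + 3) * x ^ 3) * V) {0..pi}"
        using has_integral_sin_cubed_powr[of x a] x a by (simp add: V_def add.commute)
      moreover have "((\<lambda>t. sin t ^ 3 * (1 - x * cos t) powr a) has_integral
          2 / ((a + 1) * (a + 3) * x ^ 3) * V) {0..pi}"
      proof -
        \<comment> \<open>\<open>V\<close> is odd in \<open>x\<close>, and so is
          \<open>x ^ 3\<close>; the closed form is therefore even and both summands have the same
          integral.\<close>
        have "2 / ((a + 1) * (a + 3) * (- x) ^ 3) *
            ((1 - x) powr (a + 2) * (- x - 1 / (a + 2)) + (1 + x) powr (a + 2) * (- x + 1 / (a + 2)))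
          = 2 / ((a + 1) * (a + 3) * x ^ 3) * V"
        proof -
          have "(1 - x) powr (a + 2) * (- x - 1 / (a + 2)) + (1 + x) powr (a + 2) * (- x + 1 / (a + 2))
            = - V" by (simp add: V_def algebra_simps)
          then show ?thesis by simp
        qed
        then show ?thesis
          using has_integral_sin_cubed_powr[of "- x" a] x a by simp
      qed
      ultimately show ?thesis
        unfolding f_def distrib_left by (rule has_integral_add)
    qed
    moreover have "continuous_on {0..pi} f"
      unfolding f_def using one_plus_mult_cos_pos[of x] one_plus_mult_cos_pos[of "- x"] x
      by (intro continuous_intros) (auto simp: less_le)
    \<comment> \<open>The reflection fixes \<open>sin\<close> and negates \<open>cos\<close>, which
      swaps the two powers.\<close>
    moreover have "f (pi - t) = f t" for t
      by (simp add: f_def add.commute)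
    ultimately have "((\<lambda>t. t * f t) has_integral
        (pi / 2 * (2 / ((a + 1) * (a + 3) * x ^ 3) * V + 2 / ((a + 1) * (a + 3) * x ^ 3) * V))) {0..pi}"
      by (intro has_integral_mult_symmetric) auto
    moreover have "pi / 2 * (2 / ((a + 1) * (a + 3) * x ^ 3) * V + 2 / ((a + 1) * (a + 3) * x ^ 3) * V)
        = 4 * pi / 3 * (of_rat q / x ^ 3) * V"
      unfolding q by simp
    moreover have "poly (p_poly k) x / (1 - x) powr ((2 * real k - 1) / real k) +
        poly (p_tilde_poly k) x / (1 + x) powr ((2 * real k - 1) / real k) = V"
    proof -
      \<comment> \<open>Rewrites the quartic factor with the positive base \<open>1 - x\<close>, as
        \<open>power4_div_powr\<close> requires.\<close>
      have "(x - 1) ^ 4 = (1 - x) ^ 4"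
        by (simp add: power4_eq_xxxx algebra_simps)
      then have "poly (p_poly k) x = (1 - x) ^ 4 * (x + 1 / (a + 2))"
        "poly (p_tilde_poly k) x = (1 + x) ^ 4 * (x - 1 / (a + 2))"
        unfolding a p_poly_def p_tilde_poly_def by (simp_all add: algebra_simps)
      moreover have "(1 - x) ^ 4 / (1 - x) powr ((2 * real k - 1) / real k) = (1 - x) powr (a + 2)"
        "(1 + x) ^ 4 / (1 + x) powr ((2 * real k - 1) / real k) = (1 + x) powr (a + 2)"
        unfolding a_def using x assms by (intro power4_div_powr; simp)+
      ultimately show ?thesis
        by (simp add: V_def times_divide_eq_left[symmetric] del: times_divide_eq_left)
    qed
    ultimately show "((\<lambda>\<theta>. \<theta> * sin \<theta> ^ 3 *
          ((1 + x * cos \<theta>) powr (1 / real k) + (1 - x * cos \<theta>) powr (1 / real k)))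
        has_integral
        (4 * pi / 3 * (of_rat q / x ^ 3) *
          (poly (p_poly k) x / (1 - x) powr ((2 * real k - 1) / real k) +
           poly (p_tilde_poly k) x / (1 + x) powr ((2 * real k - 1) / real k))))
        {0..pi}"
      by (simp add: f_def a_def mult.assoc)
  qed
qed

end
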